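(* Let $\lambda$ be a nonzero real number. For every integer $n\ge0$, $$x\frac{d}{dx}F_{n,\lambda}(x)+x\frac{d}{dx}\Big(xF_{n,\lambda}(x)\Big)-n\lambda F_{n,\lambda}(x)=F_{n+1,\lambda}(x).$$
   Context: Degenerate falling factorials: $(y)_{0,\lambda}=1$ and $(y)_{n,\lambda}=y(y-\lambda)\cdots(y-(n-1)\lambda)$ for $n\ge1$. Degenerate exponential: $e_\lambda(t)=\sum_{n=0}^{\infty}\frac{(1)_{n,\lambda}}{n!}t^n$. The degenerate Fubini polynomials $F_{n,\lambda}(x)$ are defined by the generating function (formal power series in $t$) $$\frac{1}{1-x(e_{\lambda}(t)-1)}=\sum_{n=0}^{\infty}F_{n,\lambda}(x)\frac{t^{n}}{n!}.$$ *)

theory Defs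
  imports "HOL-Computational_Algebra.Computational_Algebra"
begin

definition deg_falling :: "real \<Rightarrow> real \<Rightarrow> nat \<Rightarrow> real" where
  "deg_falling lam y n = (\<Prod>k<n. y - of_nat k * lam)"

definition deg_exp :: "real \<Rightarrow> real fps" where
  "deg_exp lam = Abs_fps (\<lambda>n. deg_falling lam 1 n / fact n)"

(* 1 - x (e_lam(t) - 1), a power series in t whose coefficients are polynomials in x:
   the real coefficients of e_lam(t) are embedded as constant polynomials. *)
definition fubini_denom :: "real \<Rightarrow> real poly fps" where
  "fubini_denom lam =
     1 - fps_const [:0, 1:] * (Abs_fps (\<lambda>n. [:fps_nth (deg_exp lam) n:]) - 1)"

(* The ring of coefficients is not a field, so the inverse series is taken with
   fps_right_inverse; its second argument is the inverse of the constant coefficient,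
   here 1 (see fubini_denom_mult_gf below). *)
definition fubini_gf :: "real \<Rightarrow> real poly fps" where
  "fubini_gf lam = fps_right_inverse (fubini_denom lam) 1"

definition deg_fubini :: "real \<Rightarrow> nat \<Rightarrow> real poly" where
  "deg_fubini lam n = smult (fact n) (fps_nth (fubini_gf lam) n)"

lemma fubini_denom_nth_0: "fps_nth (fubini_denom lam) 0 = 1"
  by (simp add: fubini_denom_def deg_exp_def deg_falling_def)

lemma fubini_denom_mult_gf: "fubini_denom lam * fubini_gf lam = 1"
  unfolding fubini_gf_def
  by (rule fps_right_inverse) (simp add: fubini_denom_nth_0)

lemma fubini_gf_eq: "fubini_gf lam = Abs_fps (\<lambda>n. smult (1 / fact n) (deg_fubini lam n))"
  by (simp add: fps_eq_iff deg_fubini_def)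

lemma fubini_gf_poly:
  fixes x :: real
  shows "Abs_fps (\<lambda>n. poly (deg_fubini lam n) x / fact n)
    = inverse (1 - fps_const x * (deg_exp lam - 1))"
proof -
  define G where "G = Abs_fps (\<lambda>n. poly (deg_fubini lam n) x / fact n)"
  define D where "D = 1 - fps_const x * (deg_exp lam - 1)"
  have G: "fps_nth G n = poly (fps_nth (fubini_gf lam) n) x" for n
    by (simp add: G_def deg_fubini_def)
  have D: "fps_nth D n = poly (fps_nth (fubini_denom lam) n) x" for n
    by (simp add: D_def fubini_denom_def)
  have "fps_nth (D * G) n = fps_nth 1 n" for n
  proof -
    have "fps_nth (D * G) n = poly (fps_nth (fubini_denom lam * fubini_gf lam) n) x"
      by (simp add: fps_mult_nth G D poly_sum)
    also have "\<dots> = fps_nth 1 n"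
      by (simp add: fubini_denom_mult_gf)
    finally show ?thesis .
  qed
  hence "D * G = 1" by (simp add: fps_eq_iff)
  moreover have "fps_nth D 0 \<noteq> 0"
    by (simp add: D fubini_denom_nth_0)
  ultimately have "G = inverse D"
    by (metis fps_inverse_unique)
  thus ?thesis by (simp add: G_def D_def)
qed

end

theory Submission
  imports Defs
begin

text \<open>
  Let \<open>G\<close> be the generating function \<open>1 / D\<close>, where \<open>D = 1 - x (E - 1)\<close> and \<open>E\<close> is the
  degenerate exponential in \<open>t\<close>. The recurrence is the comparison of the coefficients of
  \<open>t^n / n!\<close> in the partial differential equation
  \<open>(1 + lam t) \<partial>\<^sub>t G = x (\<partial>\<^sub>x G + \<partial>\<^sub>x (x G))\<close>.

  For the equation itself, differentiate \<open>D G = 1\<close> in each variable (lemma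
  \<open>derivation_inverse\<close>): \<open>\<partial>\<^sub>t G = x E' G^2\<close> and \<open>\<partial>\<^sub>x G = (E - 1) G^2\<close>.
  Since \<open>(1 + lam t) E' = E\<close> (lemma \<open>deg_exp_lift_ode\<close>), the left side is \<open>x E G^2\<close>. The right
  side is \<open>x (G + (1 + x) (E - 1) G^2) = x G^2 (D + (1 + x) (E - 1))\<close>, which is again
  \<open>x E G^2\<close>.
\<close>

definition deg_exp_lift :: "real \<Rightarrow> real poly fps" where
  "deg_exp_lift lam = Abs_fps (\<lambda>n. [:fps_nth (deg_exp lam) n:])"

text \<open>
  The derivation in the polynomial variable \<open>x\<close>, with \<open>t\<close> held constant; the derivation in \<open>t\<close>
  is \<open>fps_deriv\<close>.
\<close>

definition fps_pderiv :: "real poly fps \<Rightarrow> real poly fps" where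
  "fps_pderiv F = Abs_fps (\<lambda>n. pderiv (fps_nth F n))"

lemma fps_pderiv_nth [simp]: "fps_nth (fps_pderiv F) n = pderiv (fps_nth F n)"
  by (simp add: fps_pderiv_def)

lemma fps_pderiv_1 [simp]: "fps_pderiv 1 = 0"
  by (simp add: fps_eq_iff)

lemma fps_pderiv_diff: "fps_pderiv (F - H) = fps_pderiv F - fps_pderiv H"
  by (simp add: fps_eq_iff pderiv_diff)

lemma fps_pderiv_fps_const [simp]: "fps_pderiv (fps_const p) = fps_const (pderiv p)"
  by (simp add: fps_eq_iff)

lemma fps_pderiv_deg_exp_lift [simp]: "fps_pderiv (deg_exp_lift lam) = 0"
  by (simp add: fps_eq_iff deg_exp_lift_def pderiv_pCons)

lemma fps_pderiv_mult: "fps_pderiv (F * H) = fps_pderiv F * H + F * fps_pderiv H"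
proof (rule fps_ext)
  fix n
  have "pderiv (\<Sum>i=0..n. fps_nth F i * fps_nth H (n - i)) =
      (\<Sum>i=0..n. pderiv (fps_nth F i * fps_nth H (n - i)))"
    by (rule higher_pderiv_sum [of 1, simplified])
  then show "fps_nth (fps_pderiv (F * H)) n
      = fps_nth (fps_pderiv F * H + F * fps_pderiv H) n"
    by (simp add: fps_mult_nth pderiv_mult sum.distrib mult.commute [of "pderiv _"] add.commute)
qed

text \<open>
  The quotient rule for a reciprocal, in a form that serves both the derivation in \<open>t\<close>
  and the derivation in \<open>x\<close>: \<open>d'\<close> and \<open>g'\<close> are the images of \<open>d\<close> and \<open>g\<close>, and the second
  hypothesis is the product rule applied to \<open>d g = 1\<close>.
\<close>

lemma derivation_inverse:
  fixes d d' g g' :: "'a :: comm_ring_1"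
  assumes "d * g = 1" and "d' * g + d * g' = 0"
  shows "g' = - d' * g\<^sup>2"
proof -
  have "g' = (d * g) * g'" by (simp add: assms(1))
  also have "\<dots> = (d' * g + d * g') * g - d' * g\<^sup>2"
    by (simp add: algebra_simps power2_eq_square)
  finally show ?thesis by (simp add: assms(2))
qed

lemma fps_nth_one_plus_const_X_mult_deriv:
  fixes F :: "'a :: comm_ring_1 fps"
  shows "fps_nth ((1 + fps_const c * fps_X) * fps_deriv F) n
    = of_nat (Suc n) * fps_nth F (Suc n) + of_nat n * c * fps_nth F n"
  by (cases n) (simp_all add: distrib_right mult.assoc mult.left_commute del: of_nat_Suc)

text \<open>
  Appending one factor to the falling factorial gives
  \<open>(1)\<^sub>n\<^sub>+\<^sub>1 = (1 - n lam) (1)\<^sub>n\<close>, which is this equation coefficient by coefficient.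
\<close>

lemma deg_exp_lift_ode:
  "(1 + fps_const [:lam:] * fps_X) * fps_deriv (deg_exp_lift lam) = deg_exp_lift lam"
proof (rule fps_ext)
  fix n
  have "of_nat (Suc n) * (deg_falling lam 1 (Suc n) / fact (Suc n))
      = (1 - of_nat n * lam) * (deg_falling lam 1 n / fact n)"
    by (simp add: deg_falling_def divide_simps)
  then have "of_nat (Suc n) * (deg_falling lam 1 (Suc n) / fact (Suc n))
      + of_nat n * lam * (deg_falling lam 1 n / fact n) = deg_falling lam 1 n / fact n"
    by (simp only: left_diff_distrib mult_1_left diff_add_cancel)
  then show "fps_nth ((1 + fps_const [:lam:] * fps_X) * fps_deriv (deg_exp_lift lam)) n
      = fps_nth (deg_exp_lift lam) n"
    unfolding fps_nth_one_plus_const_X_mult_deriv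
    by (simp add: deg_exp_lift_def deg_exp_def of_nat_poly mult_ac del: of_nat_Suc fact_Suc)
qed

lemma fubini_gf_pde:
  "(1 + fps_const [:lam:] * fps_X) * fps_deriv (fubini_gf lam)
    = fps_const [:0, 1:] *
      (fps_pderiv (fubini_gf lam) + fps_pderiv (fps_const [:0, 1:] * fubini_gf lam))"
proof -
  define x where "x = fps_const ([:0, 1:] :: real poly)"
  define G where "G = fubini_gf lam"
  define D where "D = fubini_denom lam"
  define E where "E = deg_exp_lift lam"
  define w where "w = 1 + fps_const [:lam:] * fps_X"
  have D: "D = 1 - x * (E - 1)"
    by (simp add: D_def x_def E_def fubini_denom_def deg_exp_lift_def)
  have DG: "D * G = 1"
    by (simp add: D_def G_def fubini_denom_mult_gf)
  have dx: "fps_pderiv x = 1" "fps_deriv x = 0"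
    by (simp_all add: x_def pderiv_pCons)
  have "fps_deriv D = - (x * fps_deriv E)"
    by (simp add: D dx)
  moreover have "fps_deriv D * G + D * fps_deriv G = 0"
    using arg_cong [OF DG, of fps_deriv] by (simp add: algebra_simps)
  ultimately have Gt: "fps_deriv G = x * fps_deriv E * G\<^sup>2"
    by (metis derivation_inverse [OF DG] minus_minus)
  have "fps_pderiv D = - (E - 1)"
    by (simp add: D fps_pderiv_diff fps_pderiv_mult dx E_def)
  moreover have "fps_pderiv D * G + D * fps_pderiv G = 0"
    using arg_cong [OF DG, of fps_pderiv] by (simp add: fps_pderiv_mult)
  ultimately have Gx: "fps_pderiv G = (E - 1) * G\<^sup>2"
    using derivation_inverse [OF DG, of "fps_pderiv D" "fps_pderiv G"] by simp
  have "w * fps_deriv G = x * (w * fps_deriv E) * G\<^sup>2"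
    by (simp add: Gt algebra_simps)
  also have "\<dots> = x * E * G\<^sup>2"
    by (simp add: w_def E_def deg_exp_lift_ode)
  \<comment> \<open>The factor \<open>D * G\<close> is 1; it is kept so that both terms carry \<open>G\<^sup>2\<close>.\<close>
  also have "\<dots> = x * ((D * G) * G + (1 + x) * (E - 1) * G\<^sup>2)"
    by (simp add: D algebra_simps power2_eq_square)
  also have "\<dots> = x * (fps_pderiv G + fps_pderiv (x * G))"
    by (simp add: DG Gx fps_pderiv_mult dx algebra_simps)
  finally show ?thesis
    by (simp add: w_def x_def G_def)
qed

theorem theorem4:
  fixes lam :: real and n :: nat
  assumes "lam \<noteq> 0"
  shows "[:0, 1:] * pderiv (deg_fubini lam n)
       + [:0, 1:] * pderiv ([:0, 1:] * deg_fubini lam n)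
       - smult (of_nat n * lam) (deg_fubini lam n)
       = deg_fubini lam (Suc n)"
proof -
  define g where "g = fps_nth (fubini_gf lam)"
  have "fps_nth ((1 + fps_const [:lam:] * fps_X) * fps_deriv (fubini_gf lam)) n
      = smult (of_nat (Suc n)) (g (Suc n)) + smult (of_nat n * lam) (g n)"
    unfolding fps_nth_one_plus_const_X_mult_deriv
    by (simp add: g_def of_nat_poly mult.commute del: of_nat_Suc)
  then have coeff: "smult (of_nat (Suc n)) (g (Suc n)) + smult (of_nat n * lam) (g n)
      = [:0, 1:] * (pderiv (g n) + pderiv ([:0, 1:] * g n))"
    unfolding fubini_gf_pde by (simp add: g_def)
  have "deg_fubini lam (Suc n) = smult (fact n) (smult (of_nat (Suc n)) (g (Suc n)))"
    by (simp add: deg_fubini_def g_def mult.commute)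
  also have "smult (of_nat (Suc n)) (g (Suc n))
      = [:0, 1:] * (pderiv (g n) + pderiv ([:0, 1:] * g n)) - smult (of_nat n * lam) (g n)"
    using coeff by (simp only: eq_diff_eq)
  finally show ?thesis
    by (simp add: deg_fubini_def g_def pderiv_smult pderiv_pCons smult_diff_right smult_add_right
        distrib_left mult.commute)
qed

end
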